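(* Let $f$ be a nonnegative real-valued multiplicative arithmetical function. For each prime $p$ put $\rho(p)=\sup_{\nu\ge 0} f(p^\nu)$, and suppose $\rho(p)<\infty$ for every prime $p$. Suppose that the product $$R=\prod_p\Big(1-\frac1p\Big)\rho(p)$$ converges unconditionally (i.e. irrespective of the order of the factors), improper limits being allowed. Then $$\limsup_{n\to\infty}\frac{f(n)}{\log\log n}\;\le\; e^{\gamma}R,$$ where $\gamma$ is Euler's constant.
   Context: A multiplicative function satisfies $f(1)=1$ and $f(mn)=f(m)f(n)$ for coprime $m,n$; in particular $\rho(p)\ge f(p^0)=1$. "Improper limits allowed" means the product may converge to $+\infty$ (or $0$), in which case $R$ denotes that value and the inequality is read in $[0,\infty]$. The product runs over all primes $p$. *)

theory Defs
  imports "HOL-Analysis.Analysis" "HOL-Computational_Algebra.Primes"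
begin

text \<open>
  Arithmetical functions have domain the positive integers; they are represented by functions
  on \<^typ>\<open>nat\<close> whose value at \<open>0\<close> is left unconstrained.
\<close>

definition multiplicative_arith_fun :: "(nat \<Rightarrow> real) \<Rightarrow> bool" where
  "multiplicative_arith_fun f \<longleftrightarrow>
     f 1 = 1 \<and> (\<forall>m n. 0 < m \<longrightarrow> 0 < n \<longrightarrow> coprime m n \<longrightarrow> f (m * n) = f m * f n)"

definition rho :: "(nat \<Rightarrow> real) \<Rightarrow> nat \<Rightarrow> ereal" where
  "rho f p = (SUP \<nu>. ereal (f (p ^ \<nu>)))"

text \<open>
  Unconditional convergence of a product over all primes: for every enumeration of the primes
  the partial products tend to the same value \<open>R\<close>. The limit is taken in the extended reals,
  so the improper limits \<open>0\<close> and \<open>\<infinity>\<close> are admitted; this differs from the library's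
  \<open>has_prod\<close>, which concerns one fixed order and treats a limit \<open>0\<close> of nonzero factors as
  divergence.
\<close>

definition has_unconditional_prime_prod :: "(nat \<Rightarrow> ereal) \<Rightarrow> ereal \<Rightarrow> bool" where
  "has_unconditional_prime_prod g R \<longleftrightarrow>
     (\<forall>\<sigma> :: nat \<Rightarrow> nat. bij_betw \<sigma> UNIV {p. prime p} \<longrightarrow>
        (\<lambda>N. \<Prod>k<N. g (\<sigma> k)) \<longlonglongrightarrow> R)"

end

theory Submission
  imports Defs "HOL-Real_Asymp.Real_Asymp"
begin

text \<open>
  Take \<open>K = \<lceil>ln ln n\<rceil>\<close> and let \<open>F\<close> consist of the primes up to \<open>exp K\<close> and the primes dividing \<open>n\<close>.
  As \<open>\<rho>(p) \<ge> 1\<close>, multiplicativity gives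
  \<open>f n \<le> \<Prod>\<^bsub>p \<in> F\<^esub> \<rho>(p) = \<Prod>\<^bsub>p \<in> F\<^esub> (1 - 1/p) \<rho>(p) \<cdot> \<Prod>\<^bsub>p \<in> F\<^esub> (1 - 1/p)\<^sup>-\<^sup>1\<close>.
  Unconditional convergence makes the first factor smaller than any given \<open>c > R\<close> as soon as \<open>F\<close>
  contains a certain finite set. In the second factor the primes up to \<open>exp K\<close> contribute at most
  \<open>K exp (\<gamma> + o(1))\<close> by Mertens' third theorem; the at most \<open>exp K / K\<close> prime factors of \<open>n\<close> above
  \<open>exp K\<close> contribute only \<open>exp (2 / K)\<close>.

  For the upper half of Mertens' third theorem, Mertens' first theorem and summation by parts yield
  convergence of \<open>\<Sum>\<^bsub>p \<le> exp K\<^esub> 1/p - H\<^sub>K\<close>. Its limit is identified, by Abel's limit theorem, from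
  the behaviour of the finite Euler products at \<open>1 + t\<close>, bounded by \<open>\<zeta>(1 + t) \<le> 1 + 1/t\<close>, as
  \<open>t \<rightarrow> 0\<close>.
\<close>

subsection \<open>Chebyshev's bound and Mertens' first theorem\<close>

lemma prod_coprime_dvd:
  fixes g :: "'a \<Rightarrow> nat"
  assumes "finite A" "\<And>a. a \<in> A \<Longrightarrow> g a dvd n"
    and "\<And>a b. a \<in> A \<Longrightarrow> b \<in> A \<Longrightarrow> a \<noteq> b \<Longrightarrow> coprime (g a) (g b)"
  shows "prod g A dvd n"
  using assms
proof (induction A rule: finite_induct)
  case (insert a A)
  have "coprime (g a) (prod g A)"
    using insert by (intro prod_coprime_right) auto
  then show ?case
    using insert by (auto intro: divides_mult)
qed auto

text \<open>Erdos's induction. An even \<open>n > 2\<close> is not prime, so \<open>n - 1\<close>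
  gives the same product. For \<open>n = 2 * m + 1\<close> the primes up to \<open>m + 1\<close> are
  covered by the induction hypothesis, and those above divide the binomial coefficient
  \<open>2 * m + 1 choose m\<close>, which is at most \<open>4 ^ m\<close>.\<close>

lemma prod_primes_le_four_power: "\<Prod>{p::nat. prime p \<and> p \<le> n} \<le> 4 ^ n"
proof (induction n rule: less_induct)
  case (less n)
  consider "n < 2" | "n = 2" | "n > 2" "even n" | m where "n = 2 * m + 1" "m \<ge> 1"
  proof (cases "even n")
    case False
    then obtain m where "n = 2 * m + 1" by (rule oddE)
    with that(1) that(4)[of m] show thesis by (cases "m = 0") auto
  next
    case True
    with that(1-3) show thesis by (cases n "2 :: nat" rule: linorder_cases) blast+
  qed
  then show ?case
  proof cases
    case 1
    then have "{p::nat. prime p \<and> p \<le> n} = {}"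
      by (auto dest: prime_ge_2_nat)
    then show ?thesis by (simp only: prod.empty) simp
  next
    case 2
    then have "{p::nat. prime p \<and> p \<le> n} = {2}"
      by (auto dest: prime_ge_2_nat)
    then show ?thesis using 2 by (simp only:) simp
  next
    case 3
    have "p \<le> n \<longleftrightarrow> p \<le> n - 1" if "prime p" for p
    proof -
      have "p \<noteq> n" using that 3 prime_odd_nat by blast
      then show ?thesis by linarith
    qed
    then have "{p::nat. prime p \<and> p \<le> n} = {p. prime p \<and> p \<le> n - 1}"
      by blast
    moreover have "\<Prod>{p::nat. prime p \<and> p \<le> n - 1} \<le> 4 ^ (n - 1)"
      using less.IH[of "n - 1"] 3 by simp
    moreover have "(4::nat) ^ (n - 1) \<le> 4 ^ n"
      by (rule power_increasing) auto
    ultimately show ?thesis by (metis order_trans)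
  next
    case (4 m)
    let ?B = "{p. prime p \<and> m + 1 < p \<and> p \<le> 2 * m + 1}"
    have split: "{p::nat. prime p \<and> p \<le> n} = {p. prime p \<and> p \<le> m + 1} \<union> ?B"
      using 4 by auto
    have "\<Prod>?B dvd (2 * m + 1 choose m)"
    proof (rule prod_coprime_dvd)
      show "p dvd (2 * m + 1 choose m)" if "p \<in> ?B" for p
      proof -
        have "2 * m + 1 - m = m + 1" "m \<le> 2 * m + 1" by simp_all
        with binomial_fact_lemma[of m "2 * m + 1"]
        have "fact m * fact (m + 1) * (2 * m + 1 choose m) = (fact (2 * m + 1) :: nat)"
          by (simp only:)
        \<comment> \<open>A prime in the range above \<open>m + 1\<close> occurs in the numerator of
          the binomial coefficient but in neither factorial of the denominator.\<close>
        moreover have "p dvd fact (2 * m + 1)" "\<not> p dvd (fact m * fact (m + 1) :: nat)"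
          using that prime_dvd_mult_iff[of p] by (auto simp del: fact_Suc simp: prime_dvd_fact_iff)
        ultimately show ?thesis
          using that prime_dvd_mult_iff by (metis (no_types, lifting) mem_Collect_eq)
      qed
    qed (auto simp: primes_coprime)
    moreover have "(2 * m + 1 choose m) \<le> 4 ^ m"
    proof -
      \<comment> \<open>The two middle coefficients are equal and together at most the row sum
        \<open>2 * 4 ^ m\<close>; using both is what saves the factor 2.\<close>
      have "(2 * m + 1 choose m) + (2 * m + 1 choose (m + 1)) \<le> (\<Sum>k\<le>2 * m + 1. 2 * m + 1 choose k)"
        using sum_mono2[of "{..2 * m + 1}" "{m, m + 1}" "\<lambda>k. 2 * m + 1 choose k"] by simp
      also have "\<dots> = 2 * 4 ^ m"
        by (simp only: choose_row_sum) (simp add: power_mult)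
      also have "(2 * m + 1 choose (m + 1)) = (2 * m + 1 choose m)"
        using binomial_symmetric[of m "2 * m + 1"] by simp
      finally show ?thesis by simp
    qed
    moreover have "(2 * m + 1 choose m) > 0" by (rule zero_less_binomial) simp
    ultimately have "\<Prod>?B \<le> 4 ^ m"
      using dvd_imp_le order_trans by blast
    moreover have "\<Prod>{p::nat. prime p \<and> p \<le> m + 1} \<le> 4 ^ (m + 1)"
      using less.IH[of "m + 1"] 4 by simp
    ultimately have "\<Prod>{p::nat. prime p \<and> p \<le> m + 1} * \<Prod>?B \<le> 4 ^ (m + 1) * 4 ^ m"
      by (rule mult_le_mono[rotated])
    also have "4 ^ (m + 1) * 4 ^ m = (4::nat) ^ n"
      using 4 by (simp flip: power_add)
    also have "\<Prod>{p::nat. prime p \<and> p \<le> m + 1} * \<Prod>?B = \<Prod>{p::nat. prime p \<and> p \<le> n}"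
      unfolding split by (rule prod.union_disjoint[symmetric]) auto
    finally show ?thesis .
  qed
qed

lemma sum_ln_primes_le: "(\<Sum>p | prime p \<and> p \<le> (n::nat). ln (real p)) \<le> real n * ln 4"
proof -
  have "(\<Sum>p | prime p \<and> p \<le> (n::nat). ln (real p)) = ln (real (\<Prod>{p. prime p \<and> p \<le> n}))"
    by (subst of_nat_prod, subst ln_prod) (auto simp: prime_gt_0_nat)
  also have "\<dots> \<le> ln (4 ^ n)"
  proof (intro ln_mono)
    show "real (\<Prod>{p. prime p \<and> p \<le> n}) > 0"
      by (auto intro!: prod_pos prime_gt_0_nat)
    have "real (\<Prod>{p. prime p \<and> p \<le> n}) \<le> real (4 ^ n)"
      using prod_primes_le_four_power[of n] by (simp only: of_nat_le_iff)
    then show "real (\<Prod>{p. prime p \<and> p \<le> n}) \<le> 4 ^ n"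
      by (simp only: of_nat_power of_nat_numeral)
  qed
  also have "\<dots> = real n * ln 4"
    by (rule ln_realpow)
  finally show ?thesis .
qed

section \<open>Mertens' first theorem, from the prime factorisation of \<open>n!\<close>\<close>

lemma power_dvd_fact_mult:
  assumes "(p::nat) > 0" shows "p ^ k dvd fact (p * k)"
proof (induction k)
  case (Suc k)
  have "p * Suc k = Suc (p * Suc k - 1)" using assms by simp
  then have "fact (p * Suc k) = (p * Suc k) * (fact (p * Suc k - 1) :: nat)"
    by (metis fact_Suc of_nat_id)
  moreover have "p ^ k dvd fact (p * Suc k - 1)"
    using Suc assms by (rule_tac dvd_trans[OF Suc fact_dvd]) (simp add: Suc_leI)
  ultimately show ?case by (auto intro: mult_dvd_mono)
qed simp

text \<open>Among \<open>1..n\<close> there are \<open>n div p\<close> multiples of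
  \<open>p\<close>, so the product of the \<open>p ^ (n div p)\<close> divides \<open>n!\<close>,
  which is at most \<open>n ^ n\<close>. Take logarithms; replacing \<open>n div p\<close> by
  \<open>n / p\<close> costs at most the sum of \<open>ln p\<close>, which Chebyshev's bound
  controls by \<open>n * ln 4\<close>.\<close>

lemma sum_ln_primes_div_le:
  assumes "(n::nat) > 0"
  shows "(\<Sum>p | prime p \<and> p \<le> (n::nat). ln (real p) / real p) \<le> ln (real n) + ln 4"
proof -
  let ?P = "{p. prime p \<and> p \<le> n}"
  have "(\<Prod>p\<in>?P. p ^ (n div p)) dvd fact n"
  proof (rule prod_coprime_dvd)
    fix p assume "p \<in> ?P"
    then have "p ^ (n div p) dvd fact (p * (n div p))"
      by (auto intro: power_dvd_fact_mult prime_gt_0_nat)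
    also have "\<dots> dvd (fact n :: nat)" by (intro fact_dvd) simp
    finally show "p ^ (n div p) dvd fact n" .
  qed (auto simp: primes_coprime)
  then have "(\<Prod>p\<in>?P. p ^ (n div p)) \<le> fact n" by (rule dvd_imp_le) simp
  also have "\<dots> \<le> n ^ n" by (metis fact_le_power of_nat_id order_refl)
  finally have "real (\<Prod>p\<in>?P. p ^ (n div p)) \<le> real (n ^ n)"
    by (simp only: of_nat_le_iff)
  then have "ln (\<Prod>p\<in>?P. real p ^ (n div p)) \<le> ln (real n ^ n)"
    by (intro ln_mono) (auto intro!: prod_pos simp: prime_gt_0_nat)
  also have "ln (\<Prod>p\<in>?P. real p ^ (n div p)) = (\<Sum>p\<in>?P. real (n div p) * ln p)"
    by (subst ln_prod) (auto simp: prime_gt_0_nat ln_realpow)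
  finally have 1: "(\<Sum>p\<in>?P. real (n div p) * ln p) \<le> n * ln n"
    using assms by (simp add: ln_realpow)
  have "real n * (\<Sum>p\<in>?P. ln (real p) / p) = (\<Sum>p\<in>?P. (n / p) * ln p)"
    by (simp add: sum_distrib_left)
  also have "\<dots> \<le> (\<Sum>p\<in>?P. (real (n div p) + 1) * ln p)"
  proof (intro sum_mono mult_right_mono)
    fix p assume "p \<in> ?P"
    then have p: "p > 0" "p \<ge> 1" by (auto simp: prime_gt_0_nat Suc_leI)
    have "real n = real p * real (n div p) + real (n mod p)"
      by (metis mult_div_mod_eq of_nat_add of_nat_mult)
    also have "real (n mod p) \<le> real p" using p by (simp add: less_imp_le)
    finally show "n / p \<le> real (n div p) + 1"
      using p by (simp add: field_simps)
    show "0 \<le> ln (real p)" using p by simp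
  qed
  also have "\<dots> = (\<Sum>p\<in>?P. real (n div p) * ln p) + (\<Sum>p\<in>?P. ln (real p))"
    by (simp add: algebra_simps sum.distrib)
  also have "\<dots> \<le> n * ln n + n * ln 4"
    using 1 sum_ln_primes_le[of n] by linarith
  finally show ?thesis using assms by (simp flip: distrib_left)
qed

text \<open>Legendre's formula in recursive form: with \<open>k = n div p\<close>, only the
  multiples \<open>p * 1, ..., p * k\<close> contribute, so the multiplicity in \<open>n!\<close> is
  \<open>k\<close> plus the multiplicity in \<open>k!\<close>. By induction the latter times
  \<open>p - 1\<close> is at most \<open>k\<close>, and
  \<open>k * (p - 1) + k = k * p \<le> n\<close>.\<close>

lemma multiplicity_fact_le:
  assumes p: "prime (p::nat)"
  shows "multiplicity p (fact n) * (p - 1) \<le> n"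
proof (induction n rule: less_induct)
  case (less n)
  show ?case
  proof (cases "n = 0")
    case False
    let ?k = "n div p"
    have p1: "p > 1" "p > 0" using p prime_gt_1_nat prime_gt_0_nat by auto
    have "multiplicity p (fact n) = (\<Sum>m\<in>{1..n}. multiplicity p m)"
      using p by (subst fact_prod, subst of_nat_id, subst prime_elem_multiplicity_prod_distrib) auto
    also have "\<dots> = (\<Sum>m\<in>(*) p ` {1..?k}. multiplicity p m)"
    proof (intro sum.mono_neutral_right ballI)
      show "(*) p ` {1..?k} \<subseteq> {1..n}"
        using p1 by (auto simp: less_eq_div_iff_mult_less_eq mult.commute)
      fix m assume m: "m \<in> {1..n} - (*) p ` {1..?k}"
      have "\<not> p dvd m"
      proof
        assume "p dvd m"
        then obtain j where "m = p * j" by blast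
        with m p1 have "j \<in> {1..?k}" by (auto simp: less_eq_div_iff_mult_less_eq mult.commute)
        with m \<open>m = p * j\<close> show False by blast
      qed
      then show "multiplicity p m = 0" by (rule not_dvd_imp_multiplicity_0)
    qed auto
    also have "\<dots> = (\<Sum>j\<in>{1..?k}. multiplicity p (p * j))"
      using p1 by (subst sum.reindex) (auto simp: inj_on_def)
    also have "\<dots> = (\<Sum>j\<in>{1..?k}. 1 + multiplicity p j)"
      using p p1 by (intro sum.cong refl) (subst prime_elem_multiplicity_mult_distrib, auto)
    also have "\<dots> = ?k + multiplicity p (fact ?k)"
      unfolding fact_prod of_nat_id using p
      by (subst prime_elem_multiplicity_prod_distrib) (auto simp: sum_Suc)
    finally have "multiplicity p (fact n) * (p - 1) = ?k * (p - 1) + multiplicity p (fact ?k) * (p - 1)"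
      by (simp add: algebra_simps)
    also have "\<dots> \<le> ?k * (p - 1) + ?k"
      using less.IH[of ?k] False p1 by simp
    also have "\<dots> = ?k * p" using p1 by (cases p) (auto simp: algebra_simps)
    also have "\<dots> \<le> n" by simp
    finally show ?thesis .
  qed simp
qed

text \<open>The single term \<open>n ^ n / n!\<close> of the exponential series at \<open>n\<close>
  is at most \<open>exp n\<close>.\<close>

lemma ln_fact_ge:
  assumes "(n::nat) > 0" shows "ln (fact n :: real) \<ge> n * ln n - n"
proof -
  have "real n ^ n / fact n \<le> exp n"
    using sum_le_suminf[OF summable_exp_generic[of "real n"], of "{n}"]
    by (simp add: exp_def divide_inverse mult.commute scaleR_conv_of_real)
  then have "ln (real n ^ n / fact n) \<le> ln (exp n)"
    using assms by (intro ln_mono) auto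
  then show ?thesis using assms by (simp add: ln_div ln_realpow)
qed

text \<open>Expand \<open>ln (n!)\<close> over the primes and bound each multiplicity by
  \<open>n / (p - 1)\<close>. Since \<open>1 / (p - 1) = 1 / p + 1 / (p * (p - 1))\<close>, the
  excess over the wanted sum is bounded by a convergent series.\<close>

lemma sum_ln_primes_div_ge:
  "\<exists>C. \<forall>n>0. ln (real n) - C \<le> (\<Sum>p | prime p \<and> p \<le> n. ln (real p) / real p)"
proof -
  \<comment> \<open>The series runs over all integers; its terms are nonnegative, and at 0 and 1 the
    vanishing denominator makes them 0.\<close>
  define C where "C = (\<Sum>n. ln (real n) / (real n * (real n - 1)))"
  have "summable (\<lambda>n. ln (real n) / (real n * (real n - 1)))"
  proof (rule summable_comparison_test_bigo)
    show "summable (\<lambda>n. norm (real n powr (-3/2)))"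
      by (simp add: summable_real_powr_iff)
    show "(\<lambda>n. ln (real n) / (real n * (real n - 1))) \<in> O(\<lambda>n. real n powr (-3/2))"
      by real_asymp
  qed
  then have C: "(\<Sum>p | prime p \<and> p \<le> (n::nat). ln (real p) / (real p * (real p - 1))) \<le> C" for n
    unfolding C_def
  proof (rule sum_le_suminf)
    fix m
    show "0 \<le> ln (real m) / (real m * (real m - 1))" by (cases "m = 0") auto
  qed auto
  \<comment> \<open>The additional 1 pays for the \<open>- n\<close> in
    \<open>ln_fact_ge\<close>.\<close>
  have "ln (real n) - (C + 1) \<le> (\<Sum>p | prime p \<and> p \<le> n. ln (real p) / real p)" if n: "n > 0" for n
  proof -
    let ?P = "{p. prime p \<and> p \<le> n}"
    have "prime_factors (fact n) = ?P"
      by (auto simp: prime_factors_dvd prime_dvd_fact_iff)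
    then have "(fact n :: nat) = (\<Prod>p\<in>?P. p ^ multiplicity p (fact n))"
      using prod_prime_factors[of "fact n :: nat"] by simp
    then have "(fact n :: real) = (\<Prod>p\<in>?P. real p ^ multiplicity p (fact n :: nat))"
      by (metis (mono_tags, lifting) of_nat_fact of_nat_power of_nat_prod prod.cong)
    then have "ln (fact n :: real) = (\<Sum>p\<in>?P. multiplicity p (fact n :: nat) * ln p)"
      by (simp only:) (subst ln_prod, auto simp: ln_realpow prime_gt_0_nat)
    also have "\<dots> \<le> (\<Sum>p\<in>?P. (n / (real p - 1)) * ln p)"
    proof (intro sum_mono mult_right_mono)
      fix p assume "p \<in> ?P"
      then have p: "p > 1" "p \<ge> 1" "prime p" using prime_gt_1_nat[of p] by auto
      then have "real (multiplicity p (fact n :: nat) * (p - 1)) \<le> real n"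
        using multiplicity_fact_le[of p n] by (simp only: of_nat_le_iff)
      then show "multiplicity p (fact n :: nat) \<le> n / (real p - 1)"
        using p by (simp add: pos_le_divide_eq of_nat_diff)
      show "0 \<le> ln (real p)" using p by simp
    qed
    also have "\<dots> = (\<Sum>p\<in>?P. n * (ln p / p + ln p / (real p * (real p - 1))))"
    proof (intro sum.cong refl)
      fix p assume "p \<in> ?P"
      then have p: "real p > 1" using prime_gt_1_nat[of p] by auto
      then have "1 / (real p - 1) = 1 / p + 1 / (real p * (real p - 1))"
        by (simp add: divide_simps)
      then have "n * (1 / (real p - 1)) * ln p = n * (1 / p + 1 / (real p * (real p - 1))) * ln p"
        by (simp only:)
      then show "n / (real p - 1) * ln p = n * (ln p / p + ln p / (real p * (real p - 1)))"
        by (simp add: algebra_simps)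
    qed
    also have "\<dots> = n * ((\<Sum>p\<in>?P. ln p / p) + (\<Sum>p\<in>?P. ln (real p) / (real p * (real p - 1))))"
      by (simp add: sum.distrib flip: sum_distrib_left)
    finally have "n * ln n - n \<le> \<dots>" using ln_fact_ge[OF n] by linarith
    then have "n * (ln n - 1) \<le> n * ((\<Sum>p\<in>?P. ln p / p) + (\<Sum>p\<in>?P. ln (real p) / (real p * (real p - 1))))"
      by (simp add: algebra_simps)
    then have "ln n - 1 \<le> (\<Sum>p\<in>?P. ln p / p) + (\<Sum>p\<in>?P. ln (real p) / (real p * (real p - 1)))"
      using n by simp
    with C[of n] show ?thesis by linarith
  qed
  then show ?thesis by blast
qed

subsection \<open>Summation by parts\<close>

text \<open>Dirichlet's test for the weights \<open>1 / (k + 1)\<close>. After summation by parts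
  the boundary term vanishes in the limit, and the remaining series is dominated by \<open>B\<close>
  times the telescoping differences of the weights.\<close>

lemma summable_div_Suc_if_bounded_partial_sums:
  fixes c :: "nat \<Rightarrow> real"
  assumes bound: "\<And>n. \<bar>\<Sum>k<n. c k\<bar> \<le> B"
  shows "summable (\<lambda>k. c k / real (Suc k))"
proof -
  define C where "C n = (\<Sum>k<n. c k)" for n
  define w where "w k = 1 / real (Suc k)" for k
  have w0: "w \<longlonglongrightarrow> 0" unfolding w_def by real_asymp
  have parts: "(\<Sum>k<n. c k * w k) = C n * w n + (\<Sum>k<n. C (Suc k) * (w k - w (Suc k)))" for n
    by (induction n) (auto simp: C_def algebra_simps)
  have "(\<lambda>n. C n * w n) \<longlonglongrightarrow> 0"
  proof (rule Lim_null_comparison)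
    show "\<forall>\<^sub>F n in sequentially. norm (C n * w n) \<le> B * w n"
      using bound by (auto simp: C_def w_def abs_mult intro!: always_eventually divide_right_mono)
    show "(\<lambda>n. B * w n) \<longlonglongrightarrow> 0"
      using w0 by (rule tendsto_mult_right_zero)
  qed
  moreover have "summable (\<lambda>k. C (Suc k) * (w k - w (Suc k)))"
  proof (rule summable_comparison_test')
    show "summable (\<lambda>k. B * (w k - w (Suc k)))"
      using telescope_summable'[OF w0] by (rule summable_mult)
    have "w (Suc k) \<le> w k" for k
      unfolding w_def by (simp add: frac_le)
    then show "norm (C (Suc k) * (w k - w (Suc k))) \<le> B * (w k - w (Suc k))" for k
      using bound[of "Suc k"] by (auto simp: abs_mult C_def intro!: mult_right_mono)
  qed
  ultimately have "convergent (\<lambda>n. \<Sum>k<n. c k * w k)"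
    unfolding parts by (auto simp: summable_iff_convergent convergentI intro!: convergent_add)
  then show ?thesis
    by (simp add: summable_iff_convergent w_def)
qed

text \<open>Abel's limit theorem. With \<open>D n\<close> the error of the \<open>n\<close>-th
  partial sum, the power series equals \<open>suminf a + (1 - x) * (\<Sum>n. D n * x ^ n)\<close>;
  as \<open>D\<close> tends to 0, the second summand tends to 0 when \<open>x\<close> tends to 1
  from below.\<close>

lemma abel_limit:
  fixes a :: "nat \<Rightarrow> real"
  assumes "summable a"
  shows "((\<lambda>x. \<Sum>n. a n * x ^ n) \<longlongrightarrow> suminf a) (at_left 1)"
proof -
  define D where "D n = (\<Sum>k\<le>n. a k) - suminf a" for n
  have D0: "D \<longlonglongrightarrow> 0"
    unfolding D_def using summable_LIMSEQ'[OF assms] by (simp add: LIM_zero)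
  then obtain B where B: "\<And>n. \<bar>D n\<bar> \<le> B"
    by (metis convergentI convergent_imp_Bseq BseqE real_norm_def)
  have summ: "summable (\<lambda>n. D n * x ^ n)" if "0 < x" "x < 1" for x :: real
  proof (rule summable_comparison_test')
    show "summable (\<lambda>n. B * x ^ n)"
      using that by (intro summable_mult summable_geometric) auto
    show "norm (D n * x ^ n) \<le> B * x ^ n" for n
      using B[of n] that by (auto simp: abs_mult power_abs intro!: mult_right_mono)
  qed
  have eq: "(\<Sum>n. a n * x ^ n) = suminf a + (1 - x) * (\<Sum>n. D n * x ^ n)"
    if x: "0 < x" "x < 1" for x :: real
  proof -
    let ?T = "\<Sum>n. D n * x ^ n"
    have T: "(\<lambda>n. D n * x ^ n) sums ?T" using summ[OF x] by (rule summable_sums)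
    have "(\<lambda>n. D (Suc n) * x ^ Suc n) sums (?T - D 0 * x ^ 0)"
      using T by (subst sums_Suc_iff) simp
    moreover have "(\<lambda>n. x * (D n * x ^ n)) sums (x * ?T)"
      using T by (rule sums_mult)
    \<comment> \<open>Multiplying by \<open>1 - x\<close> turns errors into their differences
      \<open>D (Suc n) - D n = a (Suc n)\<close>; the term \<open>a 0\<close> is restored separately
      afterwards.\<close>
    ultimately have "(\<lambda>n. D (Suc n) * x ^ Suc n - x * (D n * x ^ n)) sums (?T - D 0 * x ^ 0 - x * ?T)"
      by (rule sums_diff)
    also have "(\<lambda>n. D (Suc n) * x ^ Suc n - x * (D n * x ^ n)) = (\<lambda>n. a (Suc n) * x ^ Suc n)"
      by (auto simp: D_def algebra_simps)
    finally have "(\<lambda>n. a n * x ^ n) sums (?T - D 0 * x ^ 0 - x * ?T + a 0 * x ^ 0)"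
      by (subst (asm) sums_Suc_iff) simp
    then show ?thesis
      by (auto simp: sums_iff D_def algebra_simps)
  qed
  show ?thesis
  proof (rule tendstoI)
    fix e :: real assume e: "e > 0"
    from D0 obtain N where N: "\<And>n. n \<ge> N \<Longrightarrow> \<bar>D n\<bar> \<le> e / 2"
      using e unfolding LIMSEQ_iff by (metis diff_zero half_gt_zero less_imp_le real_norm_def)
    define M where "M = (\<Sum>n<N. \<bar>D n\<bar>)"
    have M: "M \<ge> 0" by (simp add: M_def sum_nonneg)
    \<comment> \<open>Beyond this threshold \<open>(1 - x) * M\<close> is below
      \<open>e / 2\<close>, while the indices from \<open>N\<close> on contribute at most
      \<open>e / 2\<close>. The maximum with 0 keeps \<open>x\<close> positive, and
      \<open>M + 1\<close> avoids division by 0.\<close>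
    have "max 0 (1 - e / (2 * (M + 1))) < 1"
      using e M by simp
    then have "\<forall>\<^sub>F x in at_left 1. x \<in> {max 0 (1 - e / (2 * (M + 1)))<..<1}"
      by (rule eventually_at_left_real)
    then show "\<forall>\<^sub>F x in at_left 1. dist (\<Sum>n. a n * x ^ n) (suminf a) < e"
    proof eventually_elim
      case (elim x)
      then have x: "0 < x" "x < 1" by auto
      have "\<bar>\<Sum>n<N. D n * x ^ n\<bar> \<le> M"
      proof -
        have "\<bar>D n * x ^ n\<bar> \<le> \<bar>D n\<bar>" for n
          using x power_le_one[of x n] mult_left_mono[of "x ^ n" 1 "\<bar>D n\<bar>"] by (auto simp: abs_mult power_abs)
        then show ?thesis unfolding M_def by (intro order_trans[OF sum_abs sum_mono])
      qed
      moreover have "\<bar>\<Sum>n. D (n + N) * x ^ (n + N)\<bar> \<le> (e / 2) * (1 / (1 - x))"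
      proof -
        have le: "norm (D (n + N) * x ^ (n + N)) \<le> e / 2 * x ^ n" for n
        proof -
          have "x ^ (n + N) \<le> x ^ n" using x by (intro power_decreasing) auto
          then have "\<bar>D (n + N)\<bar> * x ^ (n + N) \<le> e / 2 * x ^ n"
            using N[of "n + N"] x e by (intro mult_mono) auto
          then show ?thesis using x by (simp add: abs_mult)
        qed
        have "norm (\<Sum>n. D (n + N) * x ^ (n + N)) \<le> (\<Sum>n. e / 2 * x ^ n)"
          using x by (intro norm_suminf_le le summable_mult summable_geometric) auto
        also have "\<dots> = e / 2 * (1 / (1 - x))"
          using x by (subst suminf_mult) (auto simp: suminf_geometric summable_geometric)
        finally show ?thesis by simp
      qed
      ultimately have "\<bar>\<Sum>n. D n * x ^ n\<bar> \<le> M + (e / 2) * (1 / (1 - x))"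
        using suminf_split_initial_segment[OF summ[OF x], of N] by linarith
      then have "(1 - x) * \<bar>\<Sum>n. D n * x ^ n\<bar> \<le> (1 - x) * (M + (e / 2) * (1 / (1 - x)))"
        using x by (intro mult_left_mono) auto
      also have "\<dots> = (1 - x) * M + e / 2" using x by (simp add: field_simps)
      also have "(1 - x) * M \<le> (1 - x) * (M + 1)" using x by (intro mult_left_mono) auto
      also have "(1 - x) * (M + 1) < e / (2 * (M + 1)) * (M + 1)"
        using elim M by (intro mult_strict_right_mono) auto
      also have "\<dots> = e / 2" using M by (simp add: field_simps)
      finally show ?case
        using x by (simp add: eq[OF x] dist_real_def abs_mult)
    qed
  qed
qed

subsection \<open>Finite Euler products\<close>

text \<open>An integral comparison in discrete form: \<open>t\<close> times the term at
  \<open>n + 1\<close> is at most \<open>n powr (- t) - (n + 1) powr (- t)\<close>, which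
  telescopes. The inequality comes from \<open>ln y \<le> y - 1\<close> and
  \<open>1 + u \<le> exp u\<close>.\<close>

lemma sum_powr_le:
  assumes t: "t > (0::real)"
  shows "(\<Sum>n=1..N. real n powr (- (1 + t))) \<le> 1 + 1 / t"
proof -
  have step: "t * real (Suc n) powr (- (1 + t)) \<le> real n powr (- t) - real (Suc n) powr (- t)"
    if n: "n > 0" for n
  proof -
    let ?m = "real (Suc n)"
    have "t * (1 / ?m) \<le> t * - ln (1 - 1 / ?m)"
      using t n ln_le_minus_one[of "1 - 1 / ?m"] by (intro mult_left_mono) auto
    then have "1 + t * (1 / ?m) \<le> exp (t * - ln (1 - 1 / ?m))"
      using exp_ge_add_one_self[of "t * - ln (1 - 1 / ?m)"] by linarith
    also have "1 - 1 / ?m = n / ?m" by (simp add: field_simps)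
    also have "exp (t * - ln (n / ?m)) = real n powr (- t) / ?m powr (- t)"
      using n by (simp add: powr_def ln_div algebra_simps flip: exp_diff)
    finally have "?m powr (- t) * (1 + t * (1 / ?m)) \<le> real n powr (- t)"
      by (simp add: field_simps)
    moreover have "?m powr (- (1 + t)) = ?m powr (- t) * (1 / ?m)"
      using powr_add[of ?m "-t" "-1"] by (simp add: powr_minus_divide add.commute)
    ultimately show ?thesis by (simp add: algebra_simps)
  qed
  have pos: "t * (\<Sum>n=1..N. real n powr (- (1 + t))) \<le> t + 1 - real N powr (- t)" if "N > 0"
    using that
  proof (induction N rule: nat_induct_non_zero)
    case (Suc N)
    then show ?case using step[of N] by (simp add: distrib_left)
  qed simp
  have "t * (\<Sum>n=1..N. real n powr (- (1 + t))) \<le> t + 1"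
  proof (cases "N = 0")
    case False
    then show ?thesis
      using pos powr_ge_zero[of "real N" "-t"] by linarith
  qed (use t in simp)
  then show ?thesis using t by (simp add: field_simps)
qed

text \<open>
  Sieving by a further prime multiplies the sum over the unsieved integers by \<open>1 - p powr - s\<close>,
  and the sieved sum always retains the term 1.
\<close>

lemma prod_one_minus_powr_ge:
  assumes t: "t > (0::real)" and F: "finite F" "\<And>p. p \<in> F \<Longrightarrow> prime (p::nat)"
  shows "(\<Prod>p\<in>F. 1 - real p powr (- (1 + t))) * (1 + 1 / t) \<ge> 1"
proof -
  define h where "h n = real n powr (- (1 + t))" for n :: nat
  define A where "A F = {n::nat. n > 0 \<and> (\<forall>p\<in>F. \<not> p dvd n)}" for F
  have h_mult: "h (m * n) = h m * h n" for m n
    by (simp add: h_def powr_mult)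
  have h0: "h n \<ge> 0" for n by (simp add: h_def)
  have "summable h" using t unfolding h_def by (subst summable_real_powr_iff) auto
  then have "summable (\<lambda>n. norm (h n))" using h0 by simp
  then have summ: "h summable_on B" for B
    using norm_summable_imp_summable_on summable_on_subset_banach by blast
  have sieve: "infsum h (A F) = (\<Prod>p\<in>F. 1 - h p) * infsum h (A {})"
    using F
  proof (induction F rule: finite_induct)
    case (insert p F)
    have p: "prime p" "p > 0" using insert.prems by (auto simp: prime_gt_0_nat)
    \<comment> \<open>Since \<open>p\<close> is a prime outside \<open>F\<close>, multiplication by
      \<open>p\<close> does not change divisibility by the primes of \<open>F\<close>. Hence the
      multiples of \<open>p\<close> in \<open>A F\<close> form the dilate of \<open>A F\<close> by
      \<open>p\<close>, whose sum is \<open>h p\<close> times that over \<open>A F\<close>.\<close>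
    have "p * m \<in> A F \<longleftrightarrow> m \<in> A F" for m
    proof -
      have "q dvd p * m \<longleftrightarrow> q dvd m" if "q \<in> F" for q
        using that insert p by (metis insertCI prime_dvd_mult_iff primes_dvd_imp_eq dvd_trans dvd_triv_right)
      then show ?thesis using p by (auto simp: A_def)
    qed
    then have mult_mem: "x \<in> (*) p ` A F \<longleftrightarrow> x \<in> A F \<and> p dvd x" for x
      by (auto elim!: dvdE)
    have "x \<in> A (insert p F) \<longleftrightarrow> x \<in> A F \<and> \<not> p dvd x" for x
      by (auto simp: A_def)
    with mult_mem have A: "A F = A (insert p F) \<union> (*) p ` A F" "A (insert p F) \<inter> (*) p ` A F = {}"
      by blast+
    have "infsum h (A F) = infsum h (A (insert p F)) + infsum h ((*) p ` A F)"
      by (subst A(1), rule infsum_Un_disjoint) (use A(2) summ in auto)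
    also have "infsum h ((*) p ` A F) = infsum (h \<circ> (*) p) (A F)"
      using p by (intro infsum_reindex) (auto simp: inj_on_def)
    also have "\<dots> = h p * infsum h (A F)"
      unfolding o_def h_mult by (rule infsum_cmult_right') 
    finally have "infsum h (A (insert p F)) = (1 - h p) * infsum h (A F)"
      unfolding left_diff_distrib by linarith
    then show ?case using insert by simp
  qed simp
  \<comment> \<open>\<open>A {}\<close> consists of all positive integers, so this bounds
    \<open>\<zeta>(1 + t)\<close>.\<close>
  have "infsum h (A {}) \<le> 1 + 1 / t"
  proof (rule infsum_le_finite_sums[OF summ])
    fix G assume G: "finite G" "G \<subseteq> A {}"
    have "sum h G \<le> sum h {1..Max (insert 0 G)}"
      using G h0 by (intro sum_mono2) (auto simp: A_def Suc_le_eq)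
    then show "sum h G \<le> 1 + 1 / t"
      using sum_powr_le[OF t, of "Max (insert 0 G)"] by (simp add: h_def)
  qed
  moreover have "(\<Prod>p\<in>F. 1 - h p) \<ge> 0"
  proof (rule prod_nonneg)
    fix p assume "p \<in> F"
    then have "real p \<ge> 1" using F prime_ge_1_nat by fastforce
    then have "h p \<le> real p powr 0"
      unfolding h_def using t by (intro powr_mono) auto
    then show "1 - h p \<ge> 0" using \<open>real p \<ge> 1\<close> by simp
  qed
  moreover have "1 \<le> infsum h (A F)"
  proof -
    have "1 \<in> A F" using F not_prime_unit by (fastforce simp: A_def)
    then have "infsum h {1} \<le> infsum h (A F)"
      by (intro infsum_mono_neutral summ) (auto simp: h0)
    then show ?thesis by (simp add: h_def)
  qed
  ultimately have "1 \<le> (\<Prod>p\<in>F. 1 - h p) * (1 + 1 / t)"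
    unfolding sieve by (meson mult_left_mono order_trans)
  then show ?thesis unfolding h_def .
qed

subsection \<open>Mertens' third theorem\<close>

definition primes_upto :: "real \<Rightarrow> nat set" where
  "primes_upto x = {p. prime p \<and> real p \<le> x}"

definition prime_block :: "nat \<Rightarrow> nat set" where
  "prime_block k = {p. prime p \<and> exp (real k) < real p \<and> real p \<le> exp (real (Suc k))}"

lemma primes_upto_nat: "x \<ge> 0 \<Longrightarrow> primes_upto x = {p. prime p \<and> p \<le> nat \<lfloor>x\<rfloor>}"
  by (auto simp: primes_upto_def le_nat_floor) (metis of_nat_floor order_trans of_nat_le_iff)

lemma finite_primes_upto [simp]: "finite (primes_upto x)"
  by (rule finite_subset[of _ "{..nat \<lfloor>x\<rfloor>}"]) (auto simp: primes_upto_def le_nat_floor)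

lemma finite_prime_block [simp]: "finite (prime_block k)"
  by (rule finite_subset[OF _ finite_primes_upto[of "exp (real (Suc k))"]])
    (auto simp: prime_block_def primes_upto_def)

lemma primes_upto_exp_Suc:
  "primes_upto (exp (real (Suc K))) = primes_upto (exp (real K)) \<union> prime_block K"
  "primes_upto (exp (real K)) \<inter> prime_block K = {}"
proof -
  have "exp (real K) \<le> exp (real (Suc K))" by simp
  then have "real p \<le> exp (real (Suc K)) \<longleftrightarrow>
      real p \<le> exp (real K) \<or> exp (real K) < real p \<and> real p \<le> exp (real (Suc K))" for p
    by linarith
  then show "primes_upto (exp (real (Suc K))) = primes_upto (exp (real K)) \<union> prime_block K"
    unfolding primes_upto_def prime_block_def by blast
qed (auto simp: primes_upto_def prime_block_def)

lemma sum_primes_upto_exp: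
  "(\<Sum>p\<in>primes_upto (exp (real K)). h p) = (\<Sum>k<K. \<Sum>p\<in>prime_block k. h p)"
proof (induction K)
  case 0
  \<comment> \<open>\<open>exp 0 = 1\<close> lies below every prime, so the blocks from
    \<open>k = 0\<close> on miss none.\<close>
  have "primes_upto (exp (real 0)) = {}"
    by (auto simp: primes_upto_def dest: prime_ge_2_nat)
  then show ?case by simp
next
  case (Suc K)
  then show ?case
    by (simp only: primes_upto_exp_Suc(1) sum.lessThan_Suc)
      (simp add: sum.union_disjoint primes_upto_exp_Suc(2))
qed

text \<open>Mertens' first theorem at \<open>exp K\<close>, whose logarithm is \<open>K\<close>.
  Rounding \<open>exp K\<close> down to an integer \<open>n \<ge> 1\<close> changes the logarithm by
  at most \<open>ln 2\<close>, because \<open>exp K \<le> n + 1 \<le> 2 * n\<close>.\<close>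

lemma mertens_first_exp:
  "\<exists>C. \<forall>K. \<bar>(\<Sum>p\<in>primes_upto (exp (real K)). ln (real p) / real p) - real K\<bar> \<le> C"
proof -
  obtain C where C: "\<And>n::nat. n > 0 \<Longrightarrow> (\<Sum>p | prime p \<and> p \<le> n. ln (real p) / real p) \<ge> ln (real n) - C"
    using sum_ln_primes_div_ge by blast
  have "\<bar>(\<Sum>p\<in>primes_upto (exp (real K)). ln (real p) / real p) - real K\<bar> \<le> max (ln 4) (C + ln 2)" for K
  proof -
    define n where "n = nat \<lfloor>exp (real K)\<rfloor>"
    have "exp (real K) \<ge> 1" by simp
    then have n: "n > 0" "real n \<le> exp (real K)"
      unfolding n_def by linarith+
    have "exp (real K) \<le> real n + 1"
      unfolding n_def using \<open>exp (real K) \<ge> 1\<close> by linarith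
    with n have n2: "exp (real K) \<le> 2 * real n" by simp
    have "ln (real n) \<le> ln (exp (real K))" using n by (intro ln_mono) auto
    moreover have "ln (exp (real K)) \<le> ln (2 * real n)" using n n2 by (intro ln_mono) auto
    moreover have "ln (2 * real n) = ln 2 + ln (real n)" using n by (simp add: ln_mult)
    ultimately have "ln (real n) \<le> K" "real K \<le> ln 2 + ln (real n)" by simp_all
    then show ?thesis
      using C[OF n(1)] sum_ln_primes_div_le[OF n(1)]
      by (simp add: primes_upto_nat flip: n_def)
  qed
  then show ?thesis by blast
qed

text \<open>
  With \<open>exp k\<close> as block boundaries, \<open>ln ln\<close> of the upper end of the \<open>k\<close>-th block is \<open>ln (k + 1)\<close>, so
  the reciprocal prime sums are compared with harmonic numbers, which is where \<open>\<gamma>\<close> enters.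
  The series below sums to \<open>M - \<gamma>\<close>, where \<open>M\<close> is the Meissel--Mertens constant.
\<close>

definition mertens_term :: "nat \<Rightarrow> real" where
  "mertens_term k = (\<Sum>p\<in>prime_block k. 1 / real p) - 1 / real (Suc k)"

text \<open>Write \<open>1 / p\<close> as \<open>(ln p / p) / (k + 1)\<close> plus a remainder. The
  first parts, less \<open>1 / (k + 1)\<close>, give a series to which Dirichlet's test applies, the
  partial sums of \<open>l k - 1\<close> being bounded by Mertens' first theorem. The remainders
  \<open>r k\<close> are \<open>O(1 / k^2)\<close>, since \<open>k < ln p \<le> k + 1\<close> on the
  block and \<open>l\<close> is bounded.\<close>

lemma summable_mertens_term: "summable mertens_term"
proof -
  define l where "l k = (\<Sum>p\<in>prime_block k. ln (real p) / real p)" for k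
  define r where "r k = (\<Sum>p\<in>prime_block k. 1 / real p * (1 - ln (real p) / real (Suc k)))" for k
  obtain C where C: "\<And>K. \<bar>(\<Sum>p\<in>primes_upto (exp (real K)). ln (real p) / real p) - real K\<bar> \<le> C"
    using mertens_first_exp by blast
  then have C': "\<bar>(\<Sum>k<K. l k - 1)\<bar> \<le> C" for K
    unfolding sum_primes_upto_exp by (simp add: l_def sum_subtractf)
  \<comment> \<open>\<open>l k - 1\<close> is the difference of two consecutive partial sums, each
    at most \<open>C\<close> in absolute value.\<close>
  have l_le: "l k \<le> 1 + 2 * C" for k
    using C'[of k] C'[of "Suc k"] by simp
  have block: "real p > 0" "real k < ln (real p)" "ln (real p) \<le> real (Suc k)"
    if "p \<in> prime_block k" for p k
  proof -
    show p: "real p > 0" using that by (auto simp: prime_block_def prime_gt_0_nat)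
    have "exp (real k) < real p" "real p \<le> exp (real (Suc k))"
      using that by (auto simp: prime_block_def)
    then show "real k < ln (real p)" "ln (real p) \<le> real (Suc k)"
      using p exp_less_cancel_iff[of "real k" "ln p"] exp_le_cancel_iff[of "ln p" "real (Suc k)"]
      by (simp_all only: exp_ln)
  qed
  have "summable (\<lambda>k. (l k - 1) / real (Suc k))"
    using C' by (rule summable_div_Suc_if_bounded_partial_sums)
  moreover have "summable r"
  proof (rule summable_comparison_test')
    have "summable (\<lambda>k. 1 / (real k * real (Suc k)))"
    proof (rule summable_comparison_test_bigo)
      show "summable (\<lambda>k. norm (real k powr (-2)))" by (simp add: summable_real_powr_iff)
      show "(\<lambda>k. 1 / (real k * real (Suc k))) \<in> O(\<lambda>k. real k powr (-2))" by real_asymp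
    qed
    then show "summable (\<lambda>k. (1 + 2 * C) * (1 / (real k * real (Suc k))))"
      by (rule summable_mult)
    fix k :: nat assume k: "k \<ge> 1"
    have nonneg: "0 \<le> 1 / real p * (1 - ln (real p) / real (Suc k))" if "p \<in> prime_block k" for p
      using block[OF that] by (simp add: field_simps)
    have "r k \<le> (\<Sum>p\<in>prime_block k. ln (real p) / real p * (1 / (real k * real (Suc k))))"
      unfolding r_def
    proof (rule sum_mono)
      fix p assume "p \<in> prime_block k"
      note p = block[OF this]
      have "1 - ln (real p) / real (Suc k) = (real (Suc k) - ln (real p)) / real (Suc k)"
        by (simp add: diff_divide_distrib)
      also have "\<dots> \<le> 1 / real (Suc k)"
        using p by (intro divide_right_mono) auto
      \<comment> \<open>The factor \<open>ln p / k \<ge> 1\<close> is inserted so that summing over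
        the block produces the bounded quantity \<open>l k\<close>; it requires
        \<open>k \<ge> 1\<close>.\<close>
      also have "1 / real (Suc k) \<le> ln (real p) / real k * (1 / real (Suc k))"
        using p k mult_right_mono[of 1 "ln (real p) / real k" "1 / real (Suc k)"]
        by (simp del: of_nat_Suc)
      finally have "1 / real p * (1 - ln (real p) / real (Suc k))
          \<le> 1 / real p * (ln (real p) / real k * (1 / real (Suc k)))"
        using p by (intro mult_left_mono) auto
      then show "1 / real p * (1 - ln (real p) / real (Suc k))
          \<le> ln (real p) / real p * (1 / (real k * real (Suc k)))"
        by simp
    qed
    also have "\<dots> = l k * (1 / (real k * real (Suc k)))"
      by (simp only: l_def sum_distrib_right)
    also have "\<dots> \<le> (1 + 2 * C) * (1 / (real k * real (Suc k)))"
      using l_le by (intro mult_right_mono) auto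
    finally show "norm (r k) \<le> (1 + 2 * C) * (1 / (real k * real (Suc k)))"
      using nonneg by (simp add: r_def sum_nonneg)
  qed
  ultimately have "summable (\<lambda>k. (l k - 1) / real (Suc k) + r k)"
    by (rule summable_add)
  also have "(\<lambda>k. (l k - 1) / real (Suc k) + r k) = mertens_term"
    unfolding l_def r_def mertens_term_def
    by (rule ext) (simp add: right_diff_distrib sum_subtractf diff_divide_distrib sum_divide_distrib)
  finally show ?thesis .
qed

section \<open>The sum of the Mertens series, from Euler products near 1\<close>

lemma neg_ln_one_minus_ge: "0 \<le> y \<Longrightarrow> y < 1 \<Longrightarrow> (y::real) \<le> - ln (1 - y)"
  using ln_le_minus_one[of "1 - y"] by simp

lemma sums_power_div_Suc:
  assumes "0 < x" "x < (1::real)"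
  shows "(\<lambda>k. x ^ Suc k / real (Suc k)) sums (- ln (1 - x))"
proof -
  have "(\<lambda>n. - (x ^ n) / real n) sums ln (1 - x)"
    using ln_series'[of "-x"] assms by simp
  then have "(\<lambda>n. - (x ^ Suc n) / real (Suc n)) sums ln (1 - x)"
    by (subst sums_Suc_iff) simp
  from sums_minus[OF this] show ?thesis by simp
qed

text \<open>On block \<open>k\<close>, \<open>p powr (- t) \<ge> x ^ (k + 1)\<close>. So the sum of
  \<open>p powr (- (1 + t))\<close> dominates the power series of \<open>mertens_term\<close> plus
  that of \<open>1 / (k + 1)\<close>, which is \<open>- ln (1 - x)\<close>. With the higher-order
  terms of the logarithms added, the total is at most the logarithm of a finite Euler product. These
  terms are kept only over a fixed finite \<open>G\<close>, so that \<open>t \<rightarrow> 0\<close>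
  is later taken in a finite sum.\<close>

lemma euler_product_block_bound:
  assumes t: "t > (0::real)" and G: "finite G" "\<And>p. p \<in> G \<Longrightarrow> prime (p::nat)"
  defines "x \<equiv> exp (- t)"
  shows "x * (\<Sum>k. mertens_term k * x ^ k) - ln (1 - x)
      + (\<Sum>p\<in>G. - ln (1 - real p powr (- (1 + t))) - real p powr (- (1 + t))) \<le> ln (1 + 1 / t)"
proof -
  define y where "y p = real p powr (- (1 + t))" for p :: nat
  have x: "0 < x" "x < 1" using t by (auto simp: x_def)
  have y: "0 < y p" "y p < 1" if "prime p" for p
  proof -
    have p: "real p > 1" using prime_gt_1_nat[OF that] by simp
    then show "0 < y p" by (simp add: y_def)
    have "y p < real p powr 0" unfolding y_def using p t by (intro powr_less_mono) auto
    then show "y p < 1" using p by simp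
  qed
  have bound: "(\<Sum>k<K. mertens_term k * x ^ Suc k) + (\<Sum>k<K. x ^ Suc k / real (Suc k))
      + (\<Sum>p\<in>G. - ln (1 - y p) - y p) \<le> ln (1 + 1 / t)"
    if GK: "G \<subseteq> primes_upto (exp (real K))" for K
  proof -
    let ?F = "primes_upto (exp (real K))"
    have F: "prime p" if "p \<in> ?F" for p using that by (simp add: primes_upto_def)
    have "(\<Sum>k<K. mertens_term k * x ^ Suc k) + (\<Sum>k<K. x ^ Suc k / real (Suc k))
        = (\<Sum>k<K. \<Sum>p\<in>prime_block k. 1 / real p * x ^ Suc k)"
      by (simp add: mertens_term_def left_diff_distrib sum_subtractf sum_distrib_right)
    also have "\<dots> \<le> (\<Sum>k<K. \<Sum>p\<in>prime_block k. y p)"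
    proof (intro sum_mono)
      fix k p assume p: "p \<in> prime_block k"
      then have p0: "real p > 0" by (auto simp: prime_block_def prime_gt_0_nat)
      have "real p \<le> exp (real (Suc k))" using p by (simp add: prime_block_def)
      then have "ln (real p) \<le> real (Suc k)" using p0 by (metis ln_exp ln_le_cancel_iff exp_gt_zero)
      then have "exp (- t * real (Suc k)) \<le> exp (- t * ln (real p))" using t by simp
      also have "exp (- t * real (Suc k)) = x ^ Suc k"
        unfolding x_def by (simp only: exp_of_nat2_mult[symmetric])
      also have "exp (- t * ln (real p)) = real p powr (- t)" using p0 by (simp add: powr_def)
      finally have "1 / real p * x ^ Suc k \<le> 1 / real p * real p powr (- t)"
        using p0 by (intro mult_left_mono) auto
      also have "\<dots> = y p"
        unfolding y_def using p0 powr_add[of "real p" "-1" "-t"] by (simp add: powr_minus_divide)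
      finally show "1 / real p * x ^ Suc k \<le> y p" .
    qed
    also have "\<dots> = (\<Sum>p\<in>?F. y p)" by (rule sum_primes_upto_exp[symmetric])
    \<comment> \<open>Each correction \<open>- ln (1 - y) - y\<close> is nonnegative, so
      \<open>G\<close> may be enlarged to all primes up to \<open>exp K\<close>; the linear terms
      then cancel.\<close>
    also have "\<dots> + (\<Sum>p\<in>G. - ln (1 - y p) - y p)
        \<le> (\<Sum>p\<in>?F. y p) + (\<Sum>p\<in>?F. - ln (1 - y p) - y p)"
      using GK F y neg_ln_one_minus_ge by (intro add_left_mono sum_mono2) (auto simp: less_imp_le)
    also have "\<dots> = - ln (\<Prod>p\<in>?F. 1 - y p)"
    proof -
      have "ln (\<Prod>p\<in>?F. 1 - y p) = (\<Sum>p\<in>?F. ln (1 - y p))"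
        using F y by (subst ln_prod) (force simp: less_imp_neq)+
      then show ?thesis by (simp add: sum_subtractf sum_negf)
    qed
    also have "\<dots> \<le> ln (1 + 1 / t)"
    proof -
      have pos: "(\<Prod>p\<in>?F. 1 - y p) > 0" using F y by (intro prod_pos) auto
      have "(\<Prod>p\<in>?F. 1 - y p) * (1 + 1 / t) \<ge> 1"
        unfolding y_def using t F by (intro prod_one_minus_powr_ge) auto
      then have "0 \<le> ln ((\<Prod>p\<in>?F. 1 - y p) * (1 + 1 / t))" by (rule ln_ge_zero)
      also have "\<dots> = ln (\<Prod>p\<in>?F. 1 - y p) + ln (1 + 1 / t)"
        using pos t by (intro ln_mult_pos) (auto intro: add_pos_pos)
      finally show ?thesis by simp
    qed
    finally show ?thesis by simp
  qed
  have "eventually (\<lambda>K. G \<subseteq> primes_upto (exp (real K))) sequentially"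
  proof -
    have "eventually (\<lambda>K. real (Max (insert 0 G)) \<le> exp (real K)) sequentially"
      by real_asymp
    then show ?thesis
    proof eventually_elim
      case (elim K)
      show ?case
      proof
        fix p assume p: "p \<in> G"
        with G(1) have "real p \<le> real (Max (insert 0 G))" by simp
        also note elim
        finally show "p \<in> primes_upto (exp (real K))"
          unfolding primes_upto_def using G(2)[OF p] by blast
      qed
    qed
  qed
  then have ev: "eventually (\<lambda>K. (\<Sum>k<K. mertens_term k * x ^ Suc k) + (\<Sum>k<K. x ^ Suc k / real (Suc k))
      + (\<Sum>p\<in>G. - ln (1 - y p) - y p) \<le> ln (1 + 1 / t)) sequentially"
    by eventually_elim (rule bound)
  have "summable (\<lambda>k. mertens_term k * x ^ k)"
    using powser_inside[of mertens_term 1 x] summable_mertens_term x by simp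
  then have "(\<lambda>k. x * (mertens_term k * x ^ k)) sums (x * (\<Sum>k. mertens_term k * x ^ k))"
    by (intro sums_mult summable_sums)
  then have "(\<lambda>K. \<Sum>k<K. mertens_term k * x ^ Suc k) \<longlonglongrightarrow> x * (\<Sum>k. mertens_term k * x ^ k)"
    by (simp add: sums_def mult.left_commute)
  moreover have "(\<lambda>K. \<Sum>k<K. x ^ Suc k / real (Suc k)) \<longlonglongrightarrow> - ln (1 - x)"
    using sums_power_div_Suc[OF x] by (simp only: sums_def)
  ultimately have "(\<lambda>K. (\<Sum>k<K. mertens_term k * x ^ Suc k) + (\<Sum>k<K. x ^ Suc k / real (Suc k))
      + (\<Sum>p\<in>G. - ln (1 - y p) - y p)) \<longlonglongrightarrow>
      x * (\<Sum>k. mertens_term k * x ^ k) + - ln (1 - x) + (\<Sum>p\<in>G. - ln (1 - y p) - y p)"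
    by (intro tendsto_add tendsto_const)
  from tendsto_upperbound[OF this ev] show ?thesis by (simp add: y_def)
qed

text \<open>
  This is \<open>t \<rightarrow> 0\<close> in the previous bound: the logarithmic singularities of \<open>- ln (1 - exp (- t))\<close> and
  \<open>ln (1 + 1 / t)\<close> cancel.
\<close>

lemma suminf_mertens_term_le:
  assumes G: "finite G" "\<And>p. p \<in> G \<Longrightarrow> prime (p::nat)"
  shows "(\<Sum>p\<in>G. - ln (1 - 1 / real p) - 1 / real p) \<le> - suminf mertens_term"
proof -
  let ?y = "\<lambda>p t. real p powr (- (1 + t))"
  \<comment> \<open>\<open>exp (- t)\<close> approaches 1 from below, as Abel's limit theorem
    requires.\<close>
  have x: "filterlim (\<lambda>t::real. exp (- t)) (at_left 1) (at_right 0)" by real_asymp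
  have "((\<lambda>t. \<Sum>k. mertens_term k * exp (- t) ^ k) \<longlongrightarrow> suminf mertens_term) (at_right 0)"
    by (rule filterlim_compose[OF abel_limit[OF summable_mertens_term] x])
  moreover have "((\<lambda>t::real. exp (- t)) \<longlongrightarrow> 1) (at_right 0)" by real_asymp
  ultimately have "((\<lambda>t. exp (- t) * (\<Sum>k. mertens_term k * exp (- t) ^ k)) \<longlongrightarrow> 1 * suminf mertens_term) (at_right 0)"
    by (intro tendsto_mult)
  moreover have "((\<lambda>t::real. - ln (1 - exp (- t)) - ln (1 + 1 / t)) \<longlongrightarrow> 0) (at_right 0)"
    by real_asymp
  moreover have "((\<lambda>t. \<Sum>p\<in>G. - ln (1 - ?y p t) - ?y p t) \<longlongrightarrow> (\<Sum>p\<in>G. - ln (1 - 1 / real p) - 1 / real p)) (at_right 0)"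
  proof (rule tendsto_sum)
    fix p assume "p \<in> G"
    then have p: "real p > 1" using G prime_gt_1_nat by auto
    have "(?y p \<longlongrightarrow> real p powr (- (1 + 0))) (at_right 0)"
      using p by (intro tendsto_intros) auto
    then have y: "(?y p \<longlongrightarrow> 1 / real p) (at_right 0)"
      using p by (simp add: powr_minus_divide)
    show "((\<lambda>t. - ln (1 - ?y p t) - ?y p t) \<longlongrightarrow> - ln (1 - 1 / real p) - 1 / real p) (at_right 0)"
      using p by (intro tendsto_intros y) auto
  qed
  ultimately have "((\<lambda>t. exp (- t) * (\<Sum>k. mertens_term k * exp (- t) ^ k)
      + (- ln (1 - exp (- t)) - ln (1 + 1 / t)) + (\<Sum>p\<in>G. - ln (1 - ?y p t) - ?y p t)) \<longlongrightarrow>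
      1 * suminf mertens_term + 0 + (\<Sum>p\<in>G. - ln (1 - 1 / real p) - 1 / real p)) (at_right 0)"
    by (intro tendsto_add)
  moreover have "\<forall>\<^sub>F t in at_right 0. exp (- t) * (\<Sum>k. mertens_term k * exp (- t) ^ k)
      + (- ln (1 - exp (- t)) - ln (1 + 1 / t)) + (\<Sum>p\<in>G. - ln (1 - ?y p t) - ?y p t) \<le> 0"
    using eventually_at_right_less[of "0::real"]
  proof eventually_elim
    case (elim t)
    show ?case using euler_product_block_bound[OF elim G] by linarith
  qed
  ultimately have "1 * suminf mertens_term + 0 + (\<Sum>p\<in>G. - ln (1 - 1 / real p) - 1 / real p) \<le> 0"
    by (rule tendsto_upperbound) simp
  then show ?thesis by simp
qed

text \<open>In \<open>- ln (1 - 1 / p) = 1 / p + (- ln (1 - 1 / p) - 1 / p)\<close> the first parts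
  sum to a partial sum of \<open>mertens_term\<close> plus \<open>harm K\<close>, and the second to
  at most \<open>- suminf mertens_term\<close>. The unknown constant cancels, leaving
  \<open>harm K\<close>, which is \<open>ln K + \<gamma> + o(1)\<close>.\<close>

lemma mertens_third_upper:
  obtains \<eta> :: "nat \<Rightarrow> real" where "\<eta> \<longlonglongrightarrow> 0"
    "\<And>K. K > 0 \<Longrightarrow> (\<Prod>p\<in>primes_upto (exp (real K)). 1 / (1 - 1 / real p))
        \<le> real K * exp (euler_mascheroni + \<eta> K)"
proof
  \<comment> \<open>The two errors: truncation of the Mertens series and
    \<open>harm K - ln K - \<gamma>\<close>.\<close>
  define \<eta> where "\<eta> K = ((\<Sum>k<K. mertens_term k) - suminf mertens_term)
    + ((harm K - ln (real K)) - euler_mascheroni)" for K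
  have "\<eta> \<longlonglongrightarrow> 0 + 0"
    unfolding \<eta>_def
    by (intro tendsto_add LIM_zero summable_LIMSEQ summable_mertens_term euler_mascheroni_LIMSEQ)
  then show "\<eta> \<longlonglongrightarrow> 0" by simp
  fix K :: nat assume K: "K > 0"
  let ?F = "primes_upto (exp (real K))"
  have F: "prime p" if "p \<in> ?F" for p using that by (simp add: primes_upto_def)
  have pos: "1 - 1 / real p > 0" if "p \<in> ?F" for p
    using prime_gt_1_nat[OF F[OF that]] by simp
  have harm: "(\<Sum>k<K. 1 / real (Suc k)) = harm K"
    by (induction K) (auto simp: harm_expand harm_Suc inverse_eq_divide)
  have "(\<Sum>p\<in>?F. - ln (1 - 1 / real p)) =
      (\<Sum>p\<in>?F. 1 / real p) + (\<Sum>p\<in>?F. - ln (1 - 1 / real p) - 1 / real p)"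
    by (simp add: sum_subtractf)
  also have "(\<Sum>p\<in>?F. 1 / real p) = (\<Sum>k<K. mertens_term k) + harm K"
    unfolding sum_primes_upto_exp mertens_term_def by (simp add: sum_subtractf harm del: of_nat_Suc)
  also have "(\<Sum>p\<in>?F. - ln (1 - 1 / real p) - 1 / real p) \<le> - suminf mertens_term"
    using F by (intro suminf_mertens_term_le) auto
  finally have "(\<Sum>p\<in>?F. - ln (1 - 1 / real p)) \<le> ln (real K) + (euler_mascheroni + \<eta> K)"
    by (simp add: \<eta>_def)
  then have "exp (\<Sum>p\<in>?F. - ln (1 - 1 / real p)) \<le> exp (ln (real K) + (euler_mascheroni + \<eta> K))"
    by simp
  also have "\<dots> = real K * exp (euler_mascheroni + \<eta> K)"
    using K by (simp add: exp_add)
  also have "exp (\<Sum>p\<in>?F. - ln (1 - 1 / real p)) = (\<Prod>p\<in>?F. 1 / (1 - 1 / real p))"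
    using pos by (subst exp_sum) (auto simp: exp_minus inverse_eq_divide intro!: prod.cong)
  finally show "(\<Prod>p\<in>?F. 1 / (1 - 1 / real p)) \<le> real K * exp (euler_mascheroni + \<eta> K)" .
qed

subsection \<open>Unconditional products\<close>

text \<open>The enumeration is the limit of a growing chain of distinct lists. Stage
  \<open>k\<close> extends the list so that its set satisfies \<open>Q\<close>, contains the
  \<open>k\<close>-th element of \<open>P\<close> (whence surjectivity) and has length at least
  \<open>k + 1\<close> (whence every position gets filled).\<close>

lemma exists_enumeration_through:
  assumes "infinite (P :: nat set)"
    and Q: "\<And>F. finite F \<Longrightarrow> F \<subseteq> P \<Longrightarrow> \<exists>F'. finite F' \<and> F \<subseteq> F' \<and> F' \<subseteq> P \<and> Q F'"
  shows "\<exists>\<sigma> :: nat \<Rightarrow> nat. bij_betw \<sigma> UNIV P \<and> (\<forall>k. \<exists>N\<ge>k. Q (\<sigma> ` {..<N}))"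
proof -
  define e where "e = enumerate P"
  have e: "bij_betw e UNIV P" unfolding e_def using assms(1) by (rule bij_enumerate)
  have "\<exists>L'. distinct (L @ L') \<and> set (L @ L') \<subseteq> P \<and> e k \<in> set (L @ L') \<and> Suc k \<le> length (L @ L') \<and> Q (set (L @ L'))"
    if L: "distinct L" "set L \<subseteq> P" for L k
  proof -
    have eP: "e ` {..k} \<subseteq> P" using e by (auto simp: bij_betw_def)
    obtain F' where F': "finite F'" "set L \<union> e ` {..k} \<subseteq> F'" "F' \<subseteq> P" "Q F'"
      using Q[of "set L \<union> e ` {..k}"] L eP by auto
    obtain L' where L': "set L' = F' - set L" "distinct L'"
      using finite_distinct_list[of "F' - set L"] F'(1) by auto
    have set: "set (L @ L') = F'" "distinct (L @ L')" using L' L F' by auto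
    have "Suc k = card (e ` {..k})"
      using e by (subst card_image) (auto simp: bij_betw_def intro: inj_on_subset)
    also have "\<dots> \<le> card F'" using F' by (intro card_mono) auto
    also have "\<dots> = length (L @ L')" using set distinct_card by metis
    finally show ?thesis using set F' by (intro exI[of _ L']) auto
  qed
  then obtain nxt where nxt: "\<And>L k. distinct L \<Longrightarrow> set L \<subseteq> P \<Longrightarrow>
      distinct (L @ nxt L k) \<and> set (L @ nxt L k) \<subseteq> P \<and> e k \<in> set (L @ nxt L k) \<and>
      Suc k \<le> length (L @ nxt L k) \<and> Q (set (L @ nxt L k))"
    by metis
  define L where "L = rec_nat [] (\<lambda>k L. L @ nxt L k)"
  have L_0: "L 0 = []" and L_Suc: "L (Suc k) = L k @ nxt (L k) k" for k
    by (simp_all add: L_def)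
  have good: "distinct (L k) \<and> set (L k) \<subseteq> P" for k
    by (induction k) (use nxt in \<open>auto simp: L_0 L_Suc simp del: set_append distinct_append\<close>)
  have good': "e k \<in> set (L (Suc k))" "Suc k \<le> length (L (Suc k))" "Q (set (L (Suc k)))" for k
    using nxt[of "L k" k] good[of k] by (auto simp: L_Suc)
  have pre: "length (L k) \<le> length (L m) \<and> (\<forall>i<length (L k). L m ! i = L k ! i)" if "k \<le> m" for k m
    using that by (induction m rule: dec_induct) (auto simp: L_Suc nth_append)
  \<comment> \<open>\<open>L (Suc n)\<close> has length at least \<open>n + 1\<close>, so position
    \<open>n\<close> exists there, and later stages keep it.\<close>
  define \<sigma> where "\<sigma> n = L (Suc n) ! n" for n
  have \<sigma>: "\<sigma> n = L k ! n" if "n < length (L k)" for n k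
    using that pre[of k "Suc n"] pre[of "Suc n" k] good'(2)[of n]
    by (cases "k \<le> Suc n") (auto simp: \<sigma>_def)
  have image: "\<sigma> ` {..<length (L k)} = set (L k)" for k
    using \<sigma>[of _ k] by (auto simp: in_set_conv_nth image_iff)
  have "bij_betw \<sigma> UNIV P"
  proof (rule bij_betwI')
    fix m n :: nat
    let ?k = "Suc (max m n)"
    have "m < length (L ?k)" "n < length (L ?k)" using good'(2)[of "max m n"] by auto
    then show "\<sigma> m = \<sigma> n \<longleftrightarrow> m = n"
      using \<sigma>[of _ ?k] good[of ?k] by (auto simp: nth_eq_iff_index_eq)
  next
    show "\<sigma> n \<in> P" for n
      using good'(2)[of n] good[of "Suc n"] nth_mem[of n "L (Suc n)"] by (auto simp: \<sigma>_def)
  next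
    fix p assume "p \<in> P"
    then obtain k where "p = e k" using e by (auto simp: bij_betw_def)
    then have "p \<in> set (L (Suc k))" using good'(1) by simp
    then show "\<exists>n\<in>UNIV. p = \<sigma> n" using image[of "Suc k"] by auto
  qed
  moreover have "\<exists>N\<ge>k. Q (\<sigma> ` {..<N})" for k
    using good'(2,3)[of k] image[of "Suc k"] by (intro exI[of _ "length (L (Suc k))"]) auto
  ultimately show ?thesis by blast
qed

text \<open>This converts convergence in every order into control of all large finite sets.
  Otherwise every finite set of primes would extend to one with product at least \<open>c\<close>,
  and an enumeration passing through infinitely many such sets would have partial products at least
  \<open>c\<close> infinitely often, against the limit \<open>R < c\<close>.\<close>

lemma unconditional_prime_prod_eventually_less:
  assumes "has_unconditional_prime_prod g R" "R < c"
  shows "\<exists>F0. finite F0 \<and> F0 \<subseteq> {p. prime p} \<and>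
    (\<forall>F. finite F \<longrightarrow> F0 \<subseteq> F \<longrightarrow> F \<subseteq> {p. prime p} \<longrightarrow> prod g F < c)"
  (is ?claim)
proof (rule ccontr)
  assume no: "\<not> ?claim"
  have Q: "\<exists>F'. finite F' \<and> F \<subseteq> F' \<and> F' \<subseteq> {p. prime p} \<and> \<not> prod g F' < c"
    if "finite F" "F \<subseteq> {p. prime p}" for F
  proof (rule ccontr)
    assume "\<nexists>F'. finite F' \<and> F \<subseteq> F' \<and> F' \<subseteq> {p. prime p} \<and> \<not> prod g F' < c"
    then have "\<forall>F'. finite F' \<longrightarrow> F \<subseteq> F' \<longrightarrow> F' \<subseteq> {p. prime p} \<longrightarrow> prod g F' < c"
      by metis
    with that have ?claim by (intro exI[of _ F] conjI)
    with no show False by (rule notE)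
  qed
  have "\<exists>\<sigma> :: nat \<Rightarrow> nat. bij_betw \<sigma> UNIV {p::nat. prime p} \<and> (\<forall>k. \<exists>N\<ge>k. \<not> prod g (\<sigma> ` {..<N}) < c)"
    by (rule exists_enumeration_through[OF primes_infinite, where Q = "\<lambda>F. \<not> prod g F < c"]) (rule Q)
  then obtain \<sigma> :: "nat \<Rightarrow> nat" where \<sigma>: "bij_betw \<sigma> UNIV {p::nat. prime p}"
      "\<And>k. \<exists>N\<ge>k. \<not> prod g (\<sigma> ` {..<N}) < c"
    by blast
  have "(\<lambda>N. \<Prod>k<N. g (\<sigma> k)) \<longlonglongrightarrow> R"
    using assms(1) \<sigma>(1) unfolding has_unconditional_prime_prod_def by blast
  then have "\<forall>\<^sub>F N in sequentially. (\<Prod>k<N. g (\<sigma> k)) < c"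
    using assms(2) by (rule order_tendstoD(2))
  then obtain k where "\<And>N. N \<ge> k \<Longrightarrow> (\<Prod>k<N. g (\<sigma> k)) < c"
    unfolding eventually_sequentially by blast
  moreover have "prod g (\<sigma> ` {..<N}) = (\<Prod>k<N. g (\<sigma> k))" for N
    using \<sigma>(1) by (subst prod.reindex) (auto simp: bij_betw_def intro: inj_on_subset)
  ultimately show False using \<sigma>(2)[of k] by auto
qed

subsection \<open>The maximal order\<close>

lemma multiplicative_prod_prime_powers:
  assumes f: "multiplicative_arith_fun f" and F: "finite F" "\<And>p. p \<in> F \<Longrightarrow> prime p"
  shows "f (\<Prod>p\<in>F. p ^ e p) = (\<Prod>p\<in>F. f (p ^ e p))"
  using F
proof (induction F rule: finite_induct)
  case empty
  then show ?case using f by (simp add: multiplicative_arith_fun_def)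
next
  case (insert p F)
  have "coprime (p ^ e p) (\<Prod>q\<in>F. q ^ e q)"
    using insert by (intro prod_coprime_right) (metis coprime_power_left_iff coprime_power_right_iff insertCI primes_coprime)
  moreover have "p ^ e p > 0" "(\<Prod>q\<in>F. q ^ e q) > 0"
    using insert by (auto intro!: prod_pos simp: prime_gt_0_nat)
  ultimately have "f (p ^ e p * (\<Prod>q\<in>F. q ^ e q)) = f (p ^ e p) * f (\<Prod>q\<in>F. q ^ e q)"
    using f by (simp add: multiplicative_arith_fun_def)
  then show ?case using insert by simp
qed

text \<open>The primes of \<open>F\<close> that do not divide \<open>n\<close> can be included
  because \<open>r p \<ge> f (p ^ 0) = 1\<close>.\<close>

lemma multiplicative_le_prod:
  assumes f: "multiplicative_arith_fun f" "\<And>n. n > 0 \<Longrightarrow> f n \<ge> 0"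
    and r: "\<And>p \<nu>. prime p \<Longrightarrow> f (p ^ \<nu>) \<le> r p"
    and n: "n > 0" and F: "finite F" "prime_factors n \<subseteq> F" "F \<subseteq> {p. prime p}"
  shows "f n \<le> (\<Prod>p\<in>F. r p)"
proof -
  have r1: "r p \<ge> 1" if "prime p" for p
    using r[OF that, of 0] f(1) by (simp add: multiplicative_arith_fun_def)
  have "f n = f (\<Prod>p\<in>prime_factors n. p ^ multiplicity p n)"
    using prod_prime_factors[of n] n by simp
  also have "\<dots> = (\<Prod>p\<in>prime_factors n. f (p ^ multiplicity p n))"
    using f(1) by (intro multiplicative_prod_prime_powers) auto
  also have "\<dots> \<le> (\<Prod>p\<in>prime_factors n. r p)"
    using r f(2) by (intro prod_mono) (auto simp: prime_gt_0_nat in_prime_factors_imp_prime)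
  also have "\<dots> \<le> (\<Prod>p\<in>F. r p)"
    using F r1 by (intro prod_mono2) (auto intro: order_trans[OF zero_le_one])
  finally show ?thesis .
qed

text \<open>The product of these primes divides \<open>n\<close>, so their number is at most
  \<open>ln n / K \<le> exp K / K\<close>. Each contributes at most \<open>exp (2 / exp K)\<close>,
  by \<open>- ln (1 - u) \<le> u + 2 * u^2 \<le> 2 * u\<close> for
  \<open>0 \<le> u \<le> 1 / 2\<close>.\<close>

lemma prod_large_prime_factors_le:
  assumes n: "n > 0" and K: "K > 0" "ln (real n) \<le> exp (real K)"
  shows "(\<Prod>p\<in>{p\<in>prime_factors n. exp (real K) < real p}. 1 / (1 - 1 / real p)) \<le> exp (2 / real K)"
proof -
  let ?D = "{p\<in>prime_factors n. exp (real K) < real p}"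
  have D: "prime p" "real p \<ge> 2" "exp (real K) < real p" if "p \<in> ?D" for p
    using that prime_ge_2_nat[of p] by (auto simp: in_prime_factors_imp_prime)
  have "exp (real K) ^ card ?D \<le> real n"
  proof -
    have "\<Prod>?D dvd n"
      by (rule prod_coprime_dvd) (auto intro: primes_coprime)
    then have "\<Prod>?D \<le> n" using n by (rule dvd_imp_le)
    have "exp (real K) ^ card ?D = (\<Prod>p\<in>?D. exp (real K))"
      by (rule prod_constant[symmetric])
    also have "\<dots> \<le> (\<Prod>p\<in>?D. real p)"
    proof (rule prod_mono)
      fix p assume "p \<in> ?D"
      from D(3)[OF this] show "0 \<le> exp (real K) \<and> exp (real K) \<le> real p" by simp
    qed
    also have "\<dots> = real (\<Prod>?D)" by (rule of_nat_prod[symmetric])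
    also have "\<dots> \<le> real n" using \<open>\<Prod>?D \<le> n\<close> by (simp only: of_nat_le_iff)
    finally show ?thesis .
  qed
  then have "ln (exp (real K) ^ card ?D) \<le> ln (real n)" by (intro ln_mono) auto
  then have card: "real (card ?D) * real K \<le> exp (real K)"
    using K by (simp add: ln_realpow)
  have "(\<Prod>p\<in>?D. 1 / (1 - 1 / real p)) \<le> (\<Prod>p\<in>?D. exp (2 / exp (real K)))"
  proof (rule prod_mono, intro conjI)
    fix p assume p: "p \<in> ?D"
    have p2: "1 / real p \<le> 1 / 2" "1 / real p \<ge> 0" using D(2)[OF p] by (auto simp: field_simps)
    then show "0 \<le> 1 / (1 - 1 / real p)" by simp
    have "- ln (1 - 1 / real p) \<le> 1 / real p + 2 * (1 / real p)\<^sup>2"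
      using ln_one_minus_pos_lower_bound[OF p2(2,1)] by simp
    also have "\<dots> \<le> 2 * (1 / real p)"
      using p2 mult_right_mono[OF p2(1) p2(2)] by (simp add: power2_eq_square)
    also have "\<dots> \<le> 2 * (1 / exp (real K))"
      using D(3)[OF p] by (intro mult_left_mono divide_left_mono) (auto intro: mult_pos_pos less_trans[OF exp_gt_zero])
    finally have "exp (- ln (1 - 1 / real p)) \<le> exp (2 / exp (real K))" by simp
    then show "1 / (1 - 1 / real p) \<le> exp (2 / exp (real K))"
      using p2 by (simp add: exp_minus inverse_eq_divide)
  qed
  also have "\<dots> = exp (real (card ?D) * (2 / exp (real K)))"
    by (simp only: prod_constant exp_of_nat_mult)
  also have "\<dots> \<le> exp (2 / real K)"
    using card K by (simp add: field_simps)
  finally show ?thesis .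
qed

theorem theorem1:
  fixes f :: "nat \<Rightarrow> real" and R :: ereal
  assumes "multiplicative_arith_fun f"
    and "\<And>n. n > 0 \<Longrightarrow> f n \<ge> 0"
    and "\<And>p. prime p \<Longrightarrow> rho f p < \<infinity>"
    and "has_unconditional_prime_prod (\<lambda>p. ereal (1 - 1 / real p) * rho f p) R"
  shows "limsup (\<lambda>n. ereal (f n / ln (ln (real n)))) \<le> ereal (exp euler_mascheroni) * R"
proof -
  define r where "r p = real_of_ereal (rho f p)" for p
  define g where "g p = ereal (1 - 1 / real p) * rho f p" for p
  have f_le_rho: "ereal (f (p ^ \<nu>)) \<le> rho f p" for p \<nu>
    unfolding rho_def by (rule SUP_upper) simp
  \<comment> \<open>The value at exponent 0 excludes \<open>-\<infinity>\<close>, and the hypothesis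
    excludes \<open>\<infinity>\<close>, so the rest can be computed in the reals.\<close>
  have rho: "rho f p = ereal (r p)" if "prime p" for p
  proof -
    have "ereal (f (p ^ 0)) \<le> rho f p" by (rule f_le_rho)
    then have "rho f p \<noteq> -\<infinity>" by auto
    with assms(3)[OF that] show ?thesis by (auto simp: r_def ereal_real)
  qed
  have f_le_r: "f (p ^ \<nu>) \<le> r p" if "prime p" for p \<nu>
    using f_le_rho[of p \<nu>] rho[OF that] by simp
  have r1: "r p \<ge> 1" if "prime p" for p
    using f_le_r[OF that, of 0] assms(1) by (simp add: multiplicative_arith_fun_def)
  have prod_g: "prod g F = ereal (\<Prod>p\<in>F. (1 - 1 / real p) * r p)" if "F \<subseteq> {p. prime p}" for F
  proof -
    have "prod g F = (\<Prod>p\<in>F. ereal ((1 - 1 / real p) * r p))"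
      using that by (intro prod.cong refl) (auto simp: g_def rho)
    then show ?thesis by (simp only: prod_ereal)
  qed
  have fac_pos: "1 - 1 / real p > 0" if "prime p" for p
    using prime_gt_1_nat[OF that] by simp
  obtain \<eta> :: "nat \<Rightarrow> real" where \<eta>: "\<eta> \<longlonglongrightarrow> 0"
      "\<And>K. K > 0 \<Longrightarrow> (\<Prod>p\<in>primes_upto (exp (real K)). 1 / (1 - 1 / real p))
          \<le> real K * exp (euler_mascheroni + \<eta> K)"
    using mertens_third_upper by blast
  \<comment> \<open>Letting \<open>c\<close> decrease to \<open>R\<close> gives the theorem. The
    conjunct \<open>c > 0\<close> serves to rule out \<open>R = -\<infinity>\<close>, for which
    \<open>c = -1\<close> would be admissible.\<close>
  have main: "c > 0 \<and> limsup (\<lambda>n. ereal (f n / ln (ln (real n)))) \<le> ereal (exp euler_mascheroni * c)"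
    if c: "R < ereal c" for c :: real
  proof -
    obtain F0 where F0: "finite F0" "F0 \<subseteq> {p. prime p}"
        and less: "\<And>F. finite F \<Longrightarrow> F0 \<subseteq> F \<Longrightarrow> F \<subseteq> {p. prime p} \<Longrightarrow> prod g F < ereal c"
      using unconditional_prime_prod_eventually_less[OF assms(4) c] unfolding g_def by blast
    have less': "(\<Prod>p\<in>F. (1 - 1 / real p) * r p) < c"
      if "finite F" "F0 \<subseteq> F" "F \<subseteq> {p. prime p}" for F
      using less[OF that] prod_g[OF that(3)] by simp
    have "(\<Prod>p\<in>F0. (1 - 1 / real p) * r p) \<ge> 0"
    proof (rule prod_nonneg)
      fix p assume "p \<in> F0"
      with F0(2) have "prime p" by blast
      from fac_pos[OF this] r1[OF this] show "0 \<le> (1 - 1 / real p) * r p"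
        by (intro mult_nonneg_nonneg) linarith+
    qed
    with less'[OF F0(1) subset_refl F0(2)] have c0: "c > 0" by simp
    define K where "K n = nat \<lceil>ln (ln (real n))\<rceil>" for n :: nat
    \<comment> \<open>One factor for each source: the product of \<open>(1 - 1 / p) * r p\<close>,
      Mertens' third theorem up to \<open>exp K\<close>, and the prime factors of \<open>n\<close>
      above \<open>exp K\<close>.\<close>
    define b where "b n = c * (real (K n) * exp (euler_mascheroni + \<eta> (K n))) * exp (2 / real (K n))" for n
    have lnln: "filterlim (\<lambda>n. ln (ln (real n))) at_top sequentially" by real_asymp
    have K_ge: "ln (ln (real n)) \<le> real (K n)" for n unfolding K_def by linarith
    have Klim: "filterlim (\<lambda>n. real (K n)) at_top sequentially"
      by (rule filterlim_at_top_mono[OF lnln]) (simp add: K_ge)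
    then have Klim': "filterlim K at_top sequentially"
      by (simp add: filterlim_sequentially_iff_filterlim_real)
    have F0_ev: "\<forall>\<^sub>F n in sequentially. F0 \<subseteq> primes_upto (exp (real (K n)))"
    proof -
      have "filterlim (\<lambda>n. exp (real (K n))) at_top sequentially"
        by (rule filterlim_compose[OF exp_at_top Klim])
      then have "\<forall>\<^sub>F n in sequentially. real (Max (insert 0 F0)) \<le> exp (real (K n))"
        by (simp add: filterlim_at_top)
      then show ?thesis
      proof eventually_elim
        case (elim n)
        show ?case
        proof
          fix p assume p: "p \<in> F0"
          with F0(1) have "real p \<le> real (Max (insert 0 F0))" by simp
          also note elim
          finally show "p \<in> primes_upto (exp (real (K n)))"
            unfolding primes_upto_def using F0(2) p by blast
        qed
      qed
    qed
    have ll_ev: "\<forall>\<^sub>F n in sequentially. ln (ln (real n)) > 1 \<and> ln (real n) > 0"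
      by (intro eventually_conj; real_asymp)
    have bound: "\<forall>\<^sub>F n in sequentially. ereal (f n / ln (ln (real n))) \<le> ereal (b n / ln (ln (real n)))"
      using F0_ev ll_ev eventually_gt_at_top[of 0]
    proof eventually_elim
      case (elim n)
      let ?P = "primes_upto (exp (real (K n)))" and ?D = "{p\<in>prime_factors n. exp (real (K n)) < real p}"
      have fin: "finite (?P \<union> ?D)" by simp
      have F: "prime_factors n \<subseteq> ?P \<union> ?D" "?P \<union> ?D \<subseteq> {p. prime p}" "F0 \<subseteq> ?P \<union> ?D"
          "?P \<inter> ?D = {}"
        using elim(1) by (auto simp: primes_upto_def in_prime_factors_imp_prime)
      have K: "K n > 0" using elim(2) K_ge[of n] by (cases "K n = 0") auto
      have "ln (real n) = exp (ln (ln (real n)))" using elim(2) by simp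
      also have "\<dots> \<le> exp (real (K n))" using K_ge by simp
      finally have lnK: "ln (real n) \<le> exp (real (K n))" .
      have "f n \<le> (\<Prod>p\<in>?P \<union> ?D. r p)"
        using assms(1,2) f_le_r elim(3) fin F by (intro multiplicative_le_prod) auto
      also have "\<dots> = (\<Prod>p\<in>?P \<union> ?D. (1 - 1 / real p) * r p * (1 / (1 - 1 / real p)))"
      proof (intro prod.cong refl)
        fix p assume "p \<in> ?P \<union> ?D"
        then have "1 - 1 / real p > 0" using F(2) fac_pos by blast
        moreover have "x = a * x * (1 / a)" if "a > 0" for a x :: real
          using that by simp
        ultimately show "r p = (1 - 1 / real p) * r p * (1 / (1 - 1 / real p))" by blast
      qed
      also have "\<dots> = (\<Prod>p\<in>?P \<union> ?D. (1 - 1 / real p) * r p) * ((\<Prod>p\<in>?P. 1 / (1 - 1 / real p)) * (\<Prod>p\<in>?D. 1 / (1 - 1 / real p)))"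
        using fin F(4) by (simp only: prod.distrib prod.union_disjoint finite_Un)
      also have "\<dots> \<le> c * ((real (K n) * exp (euler_mascheroni + \<eta> (K n))) * exp (2 / real (K n)))"
      proof (intro mult_mono)
        show "(\<Prod>p\<in>?P \<union> ?D. (1 - 1 / real p) * r p) \<le> c"
          using less'[OF fin F(3,2)] by simp
        show "(\<Prod>p\<in>?P. 1 / (1 - 1 / real p)) \<le> real (K n) * exp (euler_mascheroni + \<eta> (K n))"
          by (rule \<eta>(2)[OF K])
        show "(\<Prod>p\<in>?D. 1 / (1 - 1 / real p)) \<le> exp (2 / real (K n))"
          using elim(3) K lnK by (rule prod_large_prime_factors_le)
        have nonneg: "1 / (1 - 1 / real p) \<ge> 0" if "p \<in> ?P \<union> ?D" for p
        proof -
          have "1 - 1 / real p > 0" using that F(2) fac_pos by blast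
          then show ?thesis by (simp only: zero_le_divide_1_iff less_imp_le)
        qed
        then show "0 \<le> (\<Prod>p\<in>?D. 1 / (1 - 1 / real p))"
          by (intro prod_nonneg) auto
        show "0 \<le> (\<Prod>p\<in>?P. 1 / (1 - 1 / real p)) * (\<Prod>p\<in>?D. 1 / (1 - 1 / real p))"
          using nonneg by (intro mult_nonneg_nonneg prod_nonneg) auto
      qed (use c0 in auto)
      also have "\<dots> = b n" by (simp add: b_def)
      finally have "f n \<le> b n" .
      moreover have "ln (ln (real n)) \<ge> 0" using elim(2) by linarith
      ultimately have "f n / ln (ln (real n)) \<le> b n / ln (ln (real n))"
        by (rule divide_right_mono)
      then show ?case by (simp only: ereal_less_eq)
    qed
    \<comment> \<open>Rounding \<open>ln ln n\<close> up adds at most 1, which is negligible against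
      \<open>ln ln n\<close>.\<close>
    have ratio: "(\<lambda>n. real (K n) / ln (ln (real n))) \<longlonglongrightarrow> 1"
    proof (rule tendsto_sandwich)
      show "\<forall>\<^sub>F n in sequentially. 1 \<le> real (K n) / ln (ln (real n))"
        using ll_ev
      proof eventually_elim
        case (elim n)
        then have "ln (ln (real n)) > 0" by linarith
        then show ?case using K_ge[of n] by (simp only: le_divide_eq_1_pos)
      qed
      show "\<forall>\<^sub>F n in sequentially. real (K n) / ln (ln (real n)) \<le> 1 + 1 / ln (ln (real n))"
        using ll_ev
      proof eventually_elim
        case (elim n)
        then have "real (K n) \<le> ln (ln (real n)) + 1" unfolding K_def by linarith
        moreover have "ln (ln (real n)) > 0" using elim by linarith
        ultimately show ?case by (simp add: field_simps)
      qed
      show "(\<lambda>n. 1 + 1 / ln (ln (real n))) \<longlonglongrightarrow> 1" by real_asymp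
    qed simp
    have "(\<lambda>n. \<eta> (K n)) \<longlonglongrightarrow> 0" by (rule filterlim_compose[OF \<eta>(1) Klim'])
    moreover have "(\<lambda>n. 2 / real (K n)) \<longlonglongrightarrow> 0"
      using Klim by (rule real_tendsto_divide_at_top[OF tendsto_const])
    ultimately have "(\<lambda>n. c * ((real (K n) / ln (ln (real n))) * exp (euler_mascheroni + \<eta> (K n))) * exp (2 / real (K n)))
        \<longlonglongrightarrow> c * (1 * exp (euler_mascheroni + 0)) * exp 0"
      using ratio by (intro tendsto_intros)
    then have "(\<lambda>n. b n / ln (ln (real n))) \<longlonglongrightarrow> exp euler_mascheroni * c"
      by (simp add: b_def mult_ac)
    then have "limsup (\<lambda>n. ereal (b n / ln (ln (real n)))) = ereal (exp euler_mascheroni * c)"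
      by (intro lim_imp_Limsup) auto
    with Limsup_mono[OF bound] c0 show ?thesis by simp
  qed
  show ?thesis
  proof (cases R)
    case (real R')
    have "limsup (\<lambda>n. ereal (f n / ln (ln (real n)))) \<le> ereal (exp euler_mascheroni * R') + ereal e"
      if e: "e > 0" for e
    proof -
      \<comment> \<open>The excess over \<open>R'\<close> is scaled so that multiplication by
        \<open>exp \<gamma>\<close> turns it into exactly \<open>e\<close>.\<close>
      have "limsup (\<lambda>n. ereal (f n / ln (ln (real n))))
          \<le> ereal (exp euler_mascheroni * (R' + e / exp euler_mascheroni))"
        using main[of "R' + e / exp euler_mascheroni"] real e by simp
      then show ?thesis by (simp add: distrib_left)
    qed
    then have "limsup (\<lambda>n. ereal (f n / ln (ln (real n)))) \<le> ereal (exp euler_mascheroni * R')"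
      by (rule ereal_le_epsilon2)
    then show ?thesis using real by simp
  next
    case PInf
    then show ?thesis by simp
  next
    case MInf
    then show ?thesis using main[of "-1"] by simp
  qed
qed

end
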